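(* Let $X$ be a topologically connected metric space, let $\mu$ be a doubling measure on $X$ whose support is $X$, and let $E\subseteq X$ be compact. Then $E$ is $(\mu,1)$-rectifiable if and only if $\underline{D}^{1}(\mu,x)>0$ for $\mu$-a.e. $x\in E$.
   Context: For a metric space $X$, $B_X(x,r)$ denotes the set of points of $X$ at distance less than $r>0$ from $x$. A Borel measure $\mu$ on $X$ is doubling if there is a constant $C_\mu>0$ such that $\mu(B_X(x,2r))\leq C_\mu\,\mu(B_X(x,r))$ for all $x\in X$ and $r>0$; balls are assumed to have finite $\mu$-measure. The support of $\mu$ being $X$ means that every ball $B_X(x,r)$ with $x\in X$, $r>0$ has positive $\mu$-measure. The lower $1$-density of $\mu$ at $x$ is $\underline{D}^{1}(\mu,x)=\liminf_{r\to 0}\frac{\mu(B_X(x,r))}{r}$. A Borel set $E\subseteq X$ is $(\mu,1)$-rectifiable if there are countably many sets $E_i\subseteq\mathbb{R}$ and Lipschitz maps $f_i:E_i\to X$, $i=1,2,\dots$, such that, with $\Gamma_i=f_i(E_i)$, one has $\mu\left(E\setminus\bigcup_{i=1}^\infty\Gamma_i\right)=0$. *)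

theory Defs
  imports "HOL-Analysis.Analysis"
begin

definition doubling_measure :: "'a::metric_space measure \<Rightarrow> bool" where
  "doubling_measure \<mu> \<longleftrightarrow>
     sets \<mu> = sets borel \<and>
     (\<forall>x r. emeasure \<mu> (ball x r) < \<infinity>) \<and>
     (\<exists>C::real. C > 0 \<and>
        (\<forall>x r. r > 0 \<longrightarrow> emeasure \<mu> (ball x (2 * r)) \<le> ennreal C * emeasure \<mu> (ball x r)))"

definition measure_support :: "'a::metric_space measure \<Rightarrow> 'a set" where
  "measure_support \<mu> = {x. \<forall>r>0. emeasure \<mu> (ball x r) > 0}"

text \<open>The lower density takes values in the extended nonnegative reals, and may be infinite.\<close>

definition lower_density1 :: "'a::metric_space measure \<Rightarrow> 'a \<Rightarrow> ennreal" where
  "lower_density1 \<mu> x = Liminf (at_right 0) (\<lambda>r::real. emeasure \<mu> (ball x r) / ennreal r)"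

text \<open>
  The parameter sets \<open>A i\<close> are arbitrary, so the images \<open>f i ` A i\<close> need not be Borel;
  the uncovered part of \<open>E\<close> is required to be null for the completion of \<open>\<mu>\<close>, i.e. to be
  contained in a Borel set of measure zero (\<open>emeasure\<close> would be 0 by default on
  non-measurable sets). The values of \<open>f i\<close> outside \<open>A i\<close> are irrelevant.
\<close>

definition rectifiable1 :: "'a::metric_space measure \<Rightarrow> 'a set \<Rightarrow> bool" where
  "rectifiable1 \<mu> E \<longleftrightarrow>
     E \<in> sets borel \<and>
     (\<exists>(A :: nat \<Rightarrow> real set) (f :: nat \<Rightarrow> real \<Rightarrow> 'a).
        (\<forall>i. \<exists>L. L-lipschitz_on (A i) (f i)) \<and>
        E - (\<Union>i. f i ` A i) \<in> null_sets (completion \<mu>))"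

end

theory Submission
  imports Defs
begin

text \<open>
  If \<open>E\<close> is covered by Lipschitz images of sets of reals, a point of such an image at which the
  lower density vanishes is the centre of a ball whose measure is small compared with its radius.
  A Vitali covering of the parameter set shows that the radii needed to cover all these points have
  a bounded sum, and so the points form a null set (\<open>zero_density_lipschitz_image_null\<close>).

  For the converse, the points of positive density are exhausted by countably many bounded sets
  \<open>S\<close> on which \<open>measure \<mu> (ball x r) \<ge> c * r\<close> for all \<open>r \<le> R\<close>, with constants \<open>c\<close> and \<open>R\<close>.  Each
  \<open>S\<close> is a Lipschitz image of one set of reals (\<open>lipschitz_parametrization\<close>).  To
  see this it suffices to find closed walks of bounded length through all finite subsets \<open>F\<close> of
  \<open>S\<close>, since the arrival times of these walks are functions \<open>t\<close> with \<open>dist z w \<le> \<bar>t z - t w\<bar>\<close> and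
  Tychonoff's theorem yields such a function on \<open>S\<close> (\<open>expansion_compactness\<close>).

  The walks are built by joining clusters, as in the greedy construction of a minimal spanning
  tree, at the scales \<open>R / 2 ^ n, \<dots>, R / 2, R\<close>.  Joining the clusters left over at scale \<open>r\<close> into
  clusters at scale \<open>2 * r\<close> costs a multiple of \<open>r\<close> for each cluster.  Because the space is
  connected, each of several clusters is surrounded by a gap which contains a ball of radius \<open>r / 16\<close>; these
  balls are disjoint, have measure at least a multiple of \<open>r\<close>, and lie in the shell of points whose
  distance from \<open>F\<close> is between \<open>r / 4\<close> and \<open>r / 2\<close> (\<open>separated_family_gaps\<close>).  So the cost is at
  most a multiple of the measure of the shell.  The shells of different scales are
  disjoint, and therefore the total length is at most a multiple of the measure of a ball around
  \<open>S\<close> (\<open>finite_set_has_tour\<close>).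
\<close>

section \<open>Tours of finite sets\<close>

text \<open>
  A tour of \<open>K\<close> is a closed walk of length at most \<open>l\<close> through all the points of \<open>K\<close>, encoded by the
  arrival times \<open>t z\<close> of a unit-speed traveller who starts and ends at \<open>x\<close>: the time elapsed
  between two visits is at least the distance covered, and from \<open>z\<close> there is still time to return
  to \<open>x\<close>.  Since the walk is closed, it may start at any of its points.
\<close>

definition has_tour :: "'a::metric_space set \<Rightarrow> real \<Rightarrow> bool" where
  "has_tour K l \<longleftrightarrow> (\<forall>x\<in>K. \<exists>t.
     (\<forall>z\<in>K. dist x z \<le> t z \<and> t z + dist x z \<le> l) \<and>
     (\<forall>z\<in>K. \<forall>w\<in>K. dist z w \<le> \<bar>t z - t w\<bar>))"

lemma has_tour_singleton: "has_tour {x} 0"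
  unfolding has_tour_def by (auto intro!: exI[of _ "\<lambda>_. 0"])

lemma has_tour_nonneg:
  assumes "has_tour K l" "K \<noteq> {}"
  shows "0 \<le> l"
proof -
  obtain x t where x: "x \<in> K" and t: "\<forall>z\<in>K. dist x z \<le> t z \<and> t z + dist x z \<le> l"
    using assms unfolding has_tour_def by blast
  then have "dist x x \<le> t x \<and> t x + dist x x \<le> l"
    by blast
  then show ?thesis by simp
qed

lemma has_tour_mono:
  assumes "has_tour K l" "l \<le> l'"
  shows "has_tour K l'"
  unfolding has_tour_def
proof
  fix x assume "x \<in> K"
  then obtain t where t: "\<forall>z\<in>K. dist x z \<le> t z \<and> t z + dist x z \<le> l"
    and e: "\<forall>z\<in>K. \<forall>w\<in>K. dist z w \<le> \<bar>t z - t w\<bar>"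
    using assms(1) unfolding has_tour_def by blast
  from t have "\<forall>z\<in>K. dist x z \<le> t z \<and> t z + dist x z \<le> l'"
    using assms(2) by fastforce
  with e show "\<exists>t. (\<forall>z\<in>K. dist x z \<le> t z \<and> t z + dist x z \<le> l') \<and>
      (\<forall>z\<in>K. \<forall>w\<in>K. dist z w \<le> \<bar>t z - t w\<bar>)"
    by blast
qed

text \<open>
  The tour of \<open>K1\<close> is interrupted on arrival at \<open>x\<close> by an excursion: go to \<open>y\<close>, make the tour of
  \<open>K2\<close>, come back to \<open>x\<close>.  All later arrival times in \<open>K1\<close> are delayed by the duration
  \<open>l2 + 2 * d\<close> of the excursion.
\<close>

lemma tour_insert_detour:
  fixes x0 :: "'a::metric_space"
  assumes t1: "\<forall>z\<in>K1. dist x0 z \<le> t1 z \<and> t1 z + dist x0 z \<le> l1"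
    and e1: "\<forall>z\<in>K1. \<forall>w\<in>K1. dist z w \<le> \<bar>t1 z - t1 w\<bar>"
    and t2: "\<forall>z\<in>K2. dist y z \<le> t2 z \<and> t2 z + dist y z \<le> l2"
    and e2: "\<forall>z\<in>K2. \<forall>w\<in>K2. dist z w \<le> \<bar>t2 z - t2 w\<bar>"
    and x: "x \<in> K1" and y: "y \<in> K2" and d: "dist x y \<le> d"
  shows "\<exists>t. (\<forall>z\<in>K1 \<union> K2. dist x0 z \<le> t z \<and> t z + dist x0 z \<le> l1 + l2 + 2 * d) \<and>
             (\<forall>z\<in>K1 \<union> K2. \<forall>w\<in>K1 \<union> K2. dist z w \<le> \<bar>t z - t w\<bar>)"
proof -
  have d0: "0 \<le> d"
    using d zero_le_dist order_trans by blast
  define t where "t z = (if z \<in> K1 then (if t1 z \<le> t1 x then t1 z else t1 z + l2 + 2 * d)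
                         else t2 z + t1 x + d)" for z
  have l2: "0 \<le> l2" if "z \<in> K2" for z
    using that t2 by (smt (verit) zero_le_dist)
  have cross: "dist z w \<le> \<bar>t z - t w\<bar>" if z: "z \<in> K1" and w: "w \<in> K2" "w \<notin> K1" for z w
  proof -
    have a: "dist z x \<le> \<bar>t1 z - t1 x\<bar>" using e1 z x by blast
    have b: "dist z w \<le> dist z x + dist x y + dist y w"
      by (smt (verit) dist_triangle)
    have c: "dist y w \<le> t2 w \<and> t2 w + dist y w \<le> l2" using t2 w by blast
    show ?thesis
      using a b c d z w by (auto simp: t_def abs_if split: if_splits)
  qed
  have 1: "dist x0 z \<le> t z \<and> t z + dist x0 z \<le> l1 + l2 + 2 * d" if "z \<in> K1" "K2 \<noteq> {}" for z
    using t1 that(1) d0 l2 that(2) unfolding t_def by force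
  have 2: "dist x0 z \<le> t z \<and> t z + dist x0 z \<le> l1 + l2 + 2 * d" if z: "z \<in> K2" "z \<notin> K1" for z
  proof -
    have a: "dist x0 z \<le> dist x0 x + dist x y + dist y z"
      by (smt (verit) dist_triangle)
    have "dist x0 x \<le> t1 x \<and> t1 x + dist x0 x \<le> l1" using t1 x by blast
    moreover have "dist y z \<le> t2 z \<and> t2 z + dist y z \<le> l2" using t2 z by blast
    ultimately show ?thesis
      using a d z unfolding t_def by auto
  qed
  have 3: "dist z w \<le> \<bar>t z - t w\<bar>" if "z \<in> K1" "w \<in> K1" "K2 \<noteq> {}" for z w
  proof -
    have "dist z w \<le> \<bar>t1 z - t1 w\<bar>" using e1 that by blast
    moreover have "0 \<le> l2" using l2 that(3) by blast
    ultimately show ?thesis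
      using d0 that by (auto simp: t_def abs_if split: if_splits)
  qed
  have 4: "dist z w \<le> \<bar>t z - t w\<bar>" if "z \<in> K2" "w \<in> K2" "z \<notin> K1" "w \<notin> K1" for z w
    using e2 that by (auto simp: t_def)
  show ?thesis
    using 1 2 3 4 cross y by (intro exI[of _ t]) (metis Un_iff abs_minus_commute dist_commute empty_iff)
qed

lemma has_tour_Un:
  assumes "has_tour K1 l1" "has_tour K2 l2" "x \<in> K1" "y \<in> K2" "dist x y \<le> d"
  shows "has_tour (K1 \<union> K2) (l1 + l2 + 2 * d)"
  unfolding has_tour_def
proof
  obtain tx where tx: "\<forall>z\<in>K1. dist x z \<le> tx z \<and> tx z + dist x z \<le> l1"
    "\<forall>z\<in>K1. \<forall>w\<in>K1. dist z w \<le> \<bar>tx z - tx w\<bar>"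
    using assms unfolding has_tour_def by blast
  obtain ty where ty: "\<forall>z\<in>K2. dist y z \<le> ty z \<and> ty z + dist y z \<le> l2"
    "\<forall>z\<in>K2. \<forall>w\<in>K2. dist z w \<le> \<bar>ty z - ty w\<bar>"
    using assms unfolding has_tour_def by blast
  fix v assume "v \<in> K1 \<union> K2"
  then consider "v \<in> K1" | "v \<in> K2" by blast
  then show "\<exists>t. (\<forall>z\<in>K1 \<union> K2. dist v z \<le> t z \<and> t z + dist v z \<le> l1 + l2 + 2 * d) \<and>
             (\<forall>z\<in>K1 \<union> K2. \<forall>w\<in>K1 \<union> K2. dist z w \<le> \<bar>t z - t w\<bar>)"
  proof cases
    case 1
    then obtain t where t: "\<forall>z\<in>K1. dist v z \<le> t z \<and> t z + dist v z \<le> l1"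
      "\<forall>z\<in>K1. \<forall>w\<in>K1. dist z w \<le> \<bar>t z - t w\<bar>"
      using assms(1) unfolding has_tour_def by blast
    show ?thesis
      using tour_insert_detour[OF t ty assms(3-5)] .
  next
    case 2
    then obtain t where t: "\<forall>z\<in>K2. dist v z \<le> t z \<and> t z + dist v z \<le> l2"
      "\<forall>z\<in>K2. \<forall>w\<in>K2. dist z w \<le> \<bar>t z - t w\<bar>"
      using assms(2) unfolding has_tour_def by blast
    have "dist y x \<le> d" using assms(5) by (simp add: dist_commute)
    from tour_insert_detour[OF t tx assms(4,3) this] show ?thesis
      by (simp add: Un_commute add.commute[of l1])
  qed
qed

text \<open>
  The individual lengths are hidden, because the construction below only controls the total
  length of the tours of all members of a family.
\<close>

definition toured_family :: "'a::metric_space set set \<Rightarrow> real \<Rightarrow> bool" where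
  "toured_family P s \<longleftrightarrow> finite P \<and> {} \<notin> P \<and> (\<exists>l. (\<forall>K\<in>P. has_tour K (l K)) \<and> sum l P \<le> s)"

lemma toured_family_mono:
  assumes "toured_family P s" "s \<le> s'"
  shows "toured_family P s'"
  using assms unfolding toured_family_def by (meson order_trans)

definition separated :: "real \<Rightarrow> 'a::metric_space set set \<Rightarrow> bool" where
  "separated r P \<longleftrightarrow> (\<forall>K\<in>P. \<forall>K'\<in>P. K \<noteq> K' \<longrightarrow> (\<forall>x\<in>K. \<forall>y\<in>K'. r < dist x y))"

lemma toured_family_merge:
  assumes P: "toured_family P s" and K: "K \<in> P" "K' \<in> P" "K \<noteq> K'"
    and xy: "x \<in> K" "y \<in> K'" "dist x y \<le> r"
  shows "toured_family (insert (K \<union> K') (P - {K, K'})) (s + 2 * r)"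
proof -
  obtain l where l: "\<forall>K\<in>P. has_tour K (l K)" "sum l P \<le> s" and fin: "finite P" and ne: "{} \<notin> P"
    using P unfolding toured_family_def by blast
  let ?R = "P - {K, K'}" and ?U = "K \<union> K'"
  define l' where "l' = l(?U := l K + l K' + 2 * r)"
  have tour: "has_tour ?U (l K + l K' + 2 * r)"
    using has_tour_Un l K xy by blast
  have pos: "0 \<le> l J" if "J \<in> P" for J
    using that l(1) ne has_tour_nonneg by metis
  have "sum l' (insert ?U ?R) = l' ?U + sum l' (?R - {?U})"
    using fin by (simp add: sum.insert_remove)
  also have "sum l' (?R - {?U}) = sum l (?R - {?U})"
    by (intro sum.cong) (auto simp: l'_def)
  also have "\<dots> \<le> sum l ?R"
    by (intro sum_mono2) (use fin pos in auto)
  also have "l' ?U + sum l ?R = sum l P + 2 * r"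
  proof -
    have "sum l P = sum l ?R + sum l {K, K'}"
      using sum.subset_diff[of "{K, K'}" P l] K fin by simp
    then show ?thesis using K by (simp add: l'_def)
  qed
  finally have "sum l' (insert ?U ?R) \<le> s + 2 * r"
    using l(2) by simp
  moreover have "\<forall>J\<in>insert ?U ?R. has_tour J (l' J)"
    using tour l(1) by (simp add: l'_def)
  moreover have "{} \<notin> insert ?U ?R"
    using xy ne by auto
  ultimately show ?thesis
    unfolding toured_family_def using fin by blast
qed

text \<open>
  As long as two members come within distance \<open>r\<close>, they are merged; each merger costs \<open>2 * r\<close> and
  lowers the number of members, so that the total cost is governed by the drop of that number.  This
  is the greedy construction of a minimal spanning tree, restricted to the edges of length at
  most \<open>r\<close>.
\<close>

lemma toured_family_agglomerate:
  assumes "toured_family P s" "0 \<le> r"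
  shows "\<exists>Q. toured_family Q (s + 2 * r * (real (card P) - real (card Q))) \<and> \<Union>Q = \<Union>P \<and> separated r Q"
  using assms(1)
proof (induction "card P" arbitrary: P s rule: less_induct)
  case less
  show ?case
  proof (cases "separated r P")
    case True
    then show ?thesis using less.prems by (intro exI[of _ P]) simp
  next
    case False
    then obtain K K' x y where K: "K \<in> P" "K' \<in> P" "K \<noteq> K'" and xy: "x \<in> K" "y \<in> K'" "dist x y \<le> r"
      unfolding separated_def by (meson not_less)
    \<comment> \<open>The union may already belong to the family, so that the number of members
      drops by at least one, and possibly by two.\<close>
    let ?P = "insert (K \<union> K') (P - {K, K'})"
    have fin: "finite P" using less.prems by (simp add: toured_family_def)
    have "card (P - {K, K'}) = card P - 2"
      using K card_Diff_subset[of "{K, K'}" P] by simp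
    moreover have "2 \<le> card P"
      using card_mono[of P "{K, K'}"] K fin by simp
    moreover have "card ?P \<le> Suc (card (P - {K, K'}))"
      by (simp add: card_insert_le_m1 card_insert_if fin)
    ultimately have card: "card ?P + 1 \<le> card P" by linarith
    obtain Q where Q: "toured_family Q (s + 2 * r + 2 * r * (real (card ?P) - real (card Q)))"
      "\<Union>Q = \<Union>?P" "separated r Q"
      using less.hyps[of ?P, OF _ toured_family_merge[OF less.prems K xy]] card by auto
    have "2 * r * (real (card ?P) + 1 - real (card Q)) \<le> 2 * r * (real (card P) - real (card Q))"
      using card assms(2) by (intro mult_left_mono) auto
    then have "s + 2 * r + 2 * r * (real (card ?P) - real (card Q)) \<le> s + 2 * r * (real (card P) - real (card Q))"
      by (simp add: algebra_simps)
    then have "toured_family Q (s + 2 * r * (real (card P) - real (card Q)))"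
      using Q(1) by (rule toured_family_mono[rotated])
    moreover have "\<Union>?P = \<Union>P" using K by blast
    ultimately show ?thesis using Q by metis
  qed
qed

section \<open>Gaps and a compactness principle\<close>

text \<open>
  The distance to \<open>K\<close> is a continuous function; on a connected space it takes every value between
  \<open>0\<close>, attained on \<open>K\<close>, and its value at the remote point \<open>b\<close>.  This is how the connectedness
  of the space enters.
\<close>

lemma gap_point:
  fixes K :: "'a::metric_space set"
  assumes conn: "connected (UNIV :: 'a set)" and "K \<noteq> {}" and far: "\<forall>x\<in>K. r < dist x b"
    and s: "0 \<le> s" "s < r" "s < s'"
  obtains x y where "x \<in> K" "dist x y < s'" "\<forall>z\<in>K. s \<le> dist z y"
proof -
  obtain a where a: "a \<in> K" using assms by blast
  let ?g = "\<lambda>y. infdist y K"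
  have "r \<le> ?g b"
    unfolding infdist_notempty[OF \<open>K \<noteq> {}\<close>]
    using far by (intro cINF_greatest) (auto simp: dist_commute less_imp_le \<open>K \<noteq> {}\<close>)
  moreover have "connected (range ?g)"
    by (intro connected_continuous_image conn continuous_intros)
  moreover have "?g a = 0" using a by simp
  ultimately have "s \<in> range ?g"
    using connected_contains_Icc[of "range ?g" "?g a" "?g b"] s
    by (metis atLeastAtMost_iff less_imp_le order_trans rangeI subsetD)
  then obtain y where y: "?g y = s" by auto
  have "(INF a\<in>K. dist y a) < s'"
    using y s infdist_notempty[OF \<open>K \<noteq> {}\<close>, of y] by simp
  then obtain x where "x \<in> K" "dist y x < s'"
    by (subst (asm) cINF_less_iff) (auto simp: \<open>K \<noteq> {}\<close> intro!: bdd_belowI[of _ 0])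
  moreover have "\<forall>z\<in>K. s \<le> dist z y"
    using y infdist_le by (metis dist_commute)
  ultimately show thesis using that by (metis dist_commute)
qed

text \<open>
  A map \<open>t\<close> into the reals with \<open>dist z w \<le> \<bar>t z - t w\<bar>\<close> is the inverse of a Lipschitz
  parametrization.  Finitely many of these inequalities can be met by assumption; each one defines a
  closed set of functions, and by Tychonoff the functions into \<open>{0..L}\<close> form a compact set.
\<close>

lemma expansion_compactness:
  fixes S :: "'a::metric_space set"
  assumes fin: "\<And>F. finite F \<Longrightarrow> F \<subseteq> S \<Longrightarrow>
      \<exists>t. (\<forall>z\<in>F. 0 \<le> t z \<and> t z \<le> L) \<and> (\<forall>z\<in>F. \<forall>w\<in>F. dist z w \<le> \<bar>t z - t w\<bar>)"
    and L: "0 \<le> (L::real)"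
  shows "\<exists>t::'a \<Rightarrow> real. \<forall>z\<in>S. \<forall>w\<in>S. dist z w \<le> \<bar>t z - t w\<bar>"
proof -
  let ?B = "PiE UNIV (\<lambda>_::'a. {0..L})"
  let ?A = "\<lambda>(z, w). {t. dist z w \<le> \<bar>t z - t w\<bar>}"
  have "compactin (product_topology (\<lambda>_::'a. euclidean) UNIV) ?B"
    by (simp add: compactin_PiE)
  then have "compact ?B"
    by (simp add: euclidean_product_topology)
  then have "?B \<inter> \<Inter>(?A ` (S \<times> S)) \<noteq> {}"
  proof (rule compact_imp_fip)
    fix T assume "T \<in> ?A ` (S \<times> S)"
    then obtain z w where T: "T = {t. dist z w \<le> \<bar>t z - t w\<bar>}" by auto
    show "closed T"
      unfolding T by (intro closed_Collect_le continuous_intros continuous_on_product_coordinates)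
  next
    fix G assume "finite G" "G \<subseteq> ?A ` (S \<times> S)"
    then obtain I where I: "finite I" "I \<subseteq> S \<times> S" "G = ?A ` I"
      by (meson finite_subset_image)
    let ?F = "fst ` I \<union> snd ` I"
    obtain t where t: "\<forall>z\<in>?F. 0 \<le> t z \<and> t z \<le> L" "\<forall>z\<in>?F. \<forall>w\<in>?F. dist z w \<le> \<bar>t z - t w\<bar>"
    proof -
      have "finite ?F" "?F \<subseteq> S" using I by auto
      from fin[OF this] show thesis using that by blast
    qed
    define t' where "t' z = (if z \<in> ?F then t z else 0)" for z
    have "t' \<in> ?B" using t(1) L by (auto simp: t'_def)
    moreover have "dist z w \<le> \<bar>t' z - t' w\<bar>" if "(z, w) \<in> I" for z w
    proof -
      have "z \<in> ?F" "w \<in> ?F" using that by force+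
      then show ?thesis using t(2) unfolding t'_def by simp
    qed
    then have "t' \<in> \<Inter>G"
      unfolding I(3) by auto
    ultimately show "?B \<inter> \<Inter>G \<noteq> {}" by blast
  qed
  then obtain t where "t \<in> \<Inter>(?A ` (S \<times> S))" by blast
  then have "\<forall>z\<in>S. \<forall>w\<in>S. dist z w \<le> \<bar>t z - t w\<bar>" by auto
  then show ?thesis by (intro exI[of _ t])
qed

section \<open>Multiscale construction of tours for a doubling measure\<close>

definition nbhd :: "'a::metric_space set \<Rightarrow> real \<Rightarrow> 'a set" where
  "nbhd F s = (\<Union>x\<in>F. ball x s)"

lemma finite_min_separation:
  fixes F :: "'a::metric_space set"
  assumes "finite F"
  obtains \<delta> where "0 < \<delta>" "\<forall>x\<in>F. \<forall>y\<in>F. x \<noteq> y \<longrightarrow> \<delta> \<le> dist x y"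
proof -
  define D where "D = insert 1 ((\<lambda>(x, y). dist x y) ` {(x, y) \<in> F \<times> F. x \<noteq> y})"
  have "finite {(x, y) \<in> F \<times> F. x \<noteq> y}"
    by (rule finite_subset[of _ "F \<times> F"]) (use assms in auto)
  then have D: "finite D" "D \<noteq> {}" unfolding D_def by auto
  have "0 < Min D"
    using D by (subst Min_gr_iff) (auto simp: D_def)
  moreover have "\<forall>x\<in>F. \<forall>y\<in>F. x \<noteq> y \<longrightarrow> Min D \<le> dist x y"
    using D by (auto intro!: Min_le simp: D_def)
  ultimately show thesis using that by blast
qed

locale doubling_space =
  fixes \<mu> :: "'a::metric_space measure" and C :: real
  assumes sets_borel: "sets \<mu> = sets borel"
    and ball_finite: "emeasure \<mu> (ball x r) < \<infinity>"
    and C_pos: "0 < C"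
    and doubling: "0 < r \<Longrightarrow> emeasure \<mu> (ball x (2 * r)) \<le> ennreal C * emeasure \<mu> (ball x r)"
begin

lemma open_in_sets: "open U \<Longrightarrow> U \<in> sets \<mu>"
  by (simp add: sets_borel)

lemma emeasure_ball: "emeasure \<mu> (ball x r) = ennreal (measure \<mu> (ball x r))"
  using ball_finite[of x r] by (intro emeasure_eq_ennreal_measure) auto

lemma measure_ball_double:
  assumes "0 < r"
  shows "measure \<mu> (ball x (2 * r)) \<le> C * measure \<mu> (ball x r)"
proof -
  have "ennreal (measure \<mu> (ball x (2 * r))) \<le> ennreal C * ennreal (measure \<mu> (ball x r))"
    using doubling[OF assms, of x] unfolding emeasure_ball .
  also have "\<dots> = ennreal (C * measure \<mu> (ball x r))"
    using C_pos by (intro ennreal_mult[symmetric]) auto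
  finally show ?thesis
    using C_pos by (subst (asm) ennreal_le_iff) auto
qed

lemma measure_ball_eight:
  assumes "0 < r"
  shows "measure \<mu> (ball x (8 * r)) \<le> C ^ 3 * measure \<mu> (ball x r)"
proof -
  have C: "0 \<le> C" using C_pos by simp
  have "measure \<mu> (ball x (8 * r)) \<le> C * measure \<mu> (ball x (4 * r))"
    using measure_ball_double[of "4 * r" x] assms by simp
  also have "measure \<mu> (ball x (4 * r)) \<le> C * measure \<mu> (ball x (2 * r))"
    using measure_ball_double[of "2 * r" x] assms by simp
  also have "measure \<mu> (ball x (2 * r)) \<le> C * measure \<mu> (ball x r)"
    using measure_ball_double[OF assms] .
  finally show ?thesis
    using C by (simp add: power3_eq_cube mult.assoc mult_left_mono)
qed

lemma measure_ball_mono: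
  assumes "A \<subseteq> ball x r" "A \<in> sets \<mu>"
  shows "emeasure \<mu> A < \<infinity>" and "measure \<mu> A \<le> measure \<mu> (ball x r)"
proof -
  have le: "emeasure \<mu> A \<le> emeasure \<mu> (ball x r)"
    using assms by (intro emeasure_mono open_in_sets) auto
  then show "emeasure \<mu> A < \<infinity>"
    using ball_finite[of x r] by (rule le_less_trans)
  show "measure \<mu> A \<le> measure \<mu> (ball x r)"
    using le ball_finite[of x r] unfolding measure_def by (intro enn2real_mono) auto
qed

lemma nbhd_in_sets: "nbhd F s \<in> sets \<mu>"
  unfolding nbhd_def by (intro open_in_sets) auto

lemma nbhd_subset_ball:
  assumes "F \<subseteq> ball x0 R"
  shows "nbhd F s \<subseteq> ball x0 (R + s)"
proof
  fix z assume "z \<in> nbhd F s"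
  then obtain x where "x \<in> F" "dist x z < s" unfolding nbhd_def by auto
  then show "z \<in> ball x0 (R + s)"
    using assms dist_triangle[of x0 z x] by auto
qed

text \<open>
  Among two or more \<open>r\<close>-separated members, each \<open>K\<close> is surrounded by a gap: there is a point \<open>y K\<close> at
  distance about \<open>r / 3\<close> from \<open>K\<close> and still further from the other members.  The balls
  \<open>B K\<close> about these points are disjoint and lie in the shell between the neighbourhoods of radius
  \<open>r / 4\<close> and \<open>r / 2\<close>, and by doubling they are not much lighter than a ball of the same radius
  about a nearby point of \<open>K\<close>.  Hence the measure of the shell bounds the number of members.
\<close>

lemma separated_family_gaps:
  assumes conn: "connected (UNIV :: 'a set)" and fin: "finite P" and ne: "{} \<notin> P"
    and sep: "separated r P" and two: "2 \<le> card P" and r: "0 < r"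
    and bdd: "\<Union>P \<subseteq> ball x0 R"
    and mass: "\<And>x. x \<in> \<Union>P \<Longrightarrow> q \<le> measure \<mu> (ball x (r / 16))"
  shows "real (card P) * q \<le> C ^ 3 * (measure \<mu> (nbhd (\<Union>P) (r / 2)) - measure \<mu> (nbhd (\<Union>P) (r / 4)))"
proof -
  have "\<exists>x y. x \<in> K \<and> dist x y < 3 * r / 8 \<and> (\<forall>z\<in>K. r / 3 \<le> dist z y)" if K: "K \<in> P" for K
  proof -
    have "\<not> P \<subseteq> {K}"
      using two card_mono[of "{K}" P] by auto
    then obtain K' where "K' \<in> P" "K' \<noteq> K" by blast
    moreover from this obtain b where "b \<in> K'" using ne by fastforce
    ultimately have "\<forall>x\<in>K. r < dist x b"
      using sep K unfolding separated_def by blast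
    moreover have "K \<noteq> {}" using K ne by blast
    moreover have "0 \<le> r / 3" "r / 3 < r" "r / 3 < 3 * r / 8" using r by auto
    ultimately show ?thesis
      using gap_point[OF conn, of K r b "r / 3" "3 * r / 8"] by metis
  qed
  then obtain x y where x: "\<And>K. K \<in> P \<Longrightarrow> x K \<in> K" and xy: "\<And>K. K \<in> P \<Longrightarrow> dist (x K) (y K) < 3 * r / 8"
    and y: "\<And>K z. K \<in> P \<Longrightarrow> z \<in> K \<Longrightarrow> r / 3 \<le> dist z (y K)"
    by metis
  define B where "B K = ball (y K) (r / 16)" for K
  let ?U = "nbhd (\<Union>P) (r / 2)" and ?V = "nbhd (\<Union>P) (r / 4)"
  have near: "dist (x K) z < 7 * r / 16" if "K \<in> P" "z \<in> B K" for K z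
    using xy[OF that(1)] that(2) dist_triangle[of "x K" z "y K"] unfolding B_def by auto
  have far: "r / 4 \<le> dist w z" if "K \<in> P" "z \<in> B K" "K' \<in> P" "w \<in> K'" for K K' z w
  proof (cases "K' = K")
    case True
    then show ?thesis
      using y[of K w] that r dist_triangle[of w "y K" z] unfolding B_def by (auto simp: dist_commute)
  next
    case False
    then have "r < dist (x K) w" using sep x that unfolding separated_def by metis
    then show ?thesis
      using near[OF that(1,2)] dist_triangle[of "x K" w z] r by (simp add: dist_commute)
  qed
  have sub: "(\<Union>K\<in>P. B K) \<subseteq> ?U - ?V"
  proof safe
    fix K z assume Kz: "K \<in> P" "z \<in> B K"
    then show "z \<in> ?U"
      using near[OF Kz] x r unfolding nbhd_def by force
    assume "z \<in> ?V"
    then obtain K' w where "K' \<in> P" "w \<in> K'" "dist w z < r / 4"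
      unfolding nbhd_def by auto
    then show False using far[OF Kz] by fastforce
  qed
  have disj: "disjoint_family_on B P"
    unfolding disjoint_family_on_def
  proof (intro ballI impI)
    fix K K' assume K: "K \<in> P" "K' \<in> P" "K \<noteq> K'"
    have False if z: "z \<in> B K" "z \<in> B K'" for z
    proof -
      have "r < dist (x K) (x K')" using sep K x unfolding separated_def by metis
      then show False
        using near[OF K(1) z(1)] near[OF K(2) z(2)] dist_triangle[of "x K" "x K'" z] r
        by (simp add: dist_commute)
    qed
    then show "B K \<inter> B K' = {}" by blast
  qed
  have UV: "?V \<subseteq> ?U" unfolding nbhd_def using r by (intro UN_mono subset_ball) auto
  have finU: "emeasure \<mu> ?U < \<infinity>"
    by (rule measure_ball_mono[OF nbhd_subset_ball[OF bdd] nbhd_in_sets])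
  have Bs: "B K \<in> sets \<mu>" for K unfolding B_def by (simp add: open_in_sets)
  have "real (card P) * q = (\<Sum>K\<in>P. q)" by simp
  also have "\<dots> \<le> (\<Sum>K\<in>P. C ^ 3 * measure \<mu> (B K))"
  proof (rule sum_mono)
    fix K assume K: "K \<in> P"
    have "q \<le> measure \<mu> (ball (x K) (r / 16))"
      using mass x K by blast
    also have "\<dots> \<le> measure \<mu> (ball (y K) (8 * (r / 16)))"
    proof (rule measure_ball_mono)
      show "ball (x K) (r / 16) \<subseteq> ball (y K) (8 * (r / 16))"
      proof
        fix z assume "z \<in> ball (x K) (r / 16)"
        then show "z \<in> ball (y K) (8 * (r / 16))"
          using xy[OF K] dist_triangle[of "y K" z "x K"] r by (simp add: dist_commute)
      qed
    qed (simp add: open_in_sets)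
    also have "\<dots> \<le> C ^ 3 * measure \<mu> (B K)"
      unfolding B_def using r by (intro measure_ball_eight) simp
    finally show "q \<le> C ^ 3 * measure \<mu> (B K)" .
  qed
  also have "\<dots> = C ^ 3 * (\<Sum>K\<in>P. measure \<mu> (B K))"
    by (simp add: sum_distrib_left)
  also have "(\<Sum>K\<in>P. measure \<mu> (B K)) = measure \<mu> (\<Union>K\<in>P. B K)"
    using fin disj Bs ball_finite unfolding B_def
    by (intro measure_finite_Union[symmetric]) (auto simp: less_top[symmetric])
  also have "C ^ 3 * measure \<mu> (\<Union>K\<in>P. B K) \<le> C ^ 3 * measure \<mu> (?U - ?V)"
  proof (intro mult_left_mono measure_mono_fmeasurable sub)
    show "?U - ?V \<in> fmeasurable \<mu>"
      using finU nbhd_in_sets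
      by (intro fmeasurable_Diff fmeasurableI) (auto simp: less_top)
  qed (use Bs fin C_pos in auto)
  also have "measure \<mu> (?U - ?V) = measure \<mu> ?U - measure \<mu> ?V"
    using finU nbhd_in_sets UV by (intro measure_Diff) auto
  finally show ?thesis .
qed

text \<open>
  Merging at scale \<open>2 * r\<close> costs at most \<open>4 * r\<close> for each member, and \<open>r\<close> times the number of
  members is bounded by the measure of a shell.  The measure of the shell is exactly the increment
  of \<open>measure \<mu> (nbhd F (r / 4))\<close> when \<open>r\<close> is doubled, and so the estimate for the total length
  reproduces itself.
\<close>

lemma toured_family_double_scale:
  assumes conn: "connected (UNIV :: 'a set)" and c: "0 < c" and r: "0 < r"
    and mass: "\<And>x. x \<in> F \<Longrightarrow> c * (r / 16) \<le> measure \<mu> (ball x (r / 16))"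
    and bdd: "F \<subseteq> ball x0 R"
    and P: "toured_family P (64 * C ^ 3 / c * measure \<mu> (nbhd F (r / 4)))" "\<Union>P = F" "separated r P"
  shows "\<exists>Q. toured_family Q (64 * C ^ 3 / c * measure \<mu> (nbhd F (2 * r / 4))) \<and> \<Union>Q = F \<and> separated (2 * r) Q"
proof -
  let ?D = "64 * C ^ 3 / c" and ?m = "\<lambda>s. measure \<mu> (nbhd F s)"
  have fin: "finite P" and ne: "{} \<notin> P" using P(1) unfolding toured_family_def by auto
  obtain Q where Q: "toured_family Q (?D * ?m (r / 4) + 2 * (2 * r) * (real (card P) - real (card Q)))"
    "\<Union>Q = F" "separated (2 * r) Q"
    using toured_family_agglomerate[OF P(1), of "2 * r"] r P(2) by auto
  have finQ: "finite Q" "{} \<notin> Q" using Q(1) unfolding toured_family_def by auto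
  have "2 * (2 * r) * (real (card P) - real (card Q)) \<le> ?D * (?m (r / 2) - ?m (r / 4))"
  proof (cases "2 \<le> card P")
    case True
    have "real (card P) * (c * (r / 16)) \<le> C ^ 3 * (?m (r / 2) - ?m (r / 4))"
      using separated_family_gaps[OF conn fin ne P(3) True r, of x0 R "c * (r / 16)"] P(2) bdd mass by simp
    then have "(64 / c) * (real (card P) * (c * (r / 16))) \<le> (64 / c) * (C ^ 3 * (?m (r / 2) - ?m (r / 4)))"
      using c by (intro mult_left_mono) auto
    moreover have "(64 / c) * (real (card P) * (c * (r / 16))) = 4 * r * real (card P)"
      using c by (simp add: field_simps)
    moreover have "2 * (2 * r) * (real (card P) - real (card Q)) \<le> 4 * r * real (card P)"
      using r by (simp add: algebra_simps)
    ultimately show ?thesis by (simp add: algebra_simps)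
  next
    case False
    \<comment> \<open>With at most one member nothing is left to merge, so the step is free.\<close>
    have "card P \<le> card Q"
    proof (cases "P = {}")
      case False
      then have "F \<noteq> {}" using P(2) ne by auto
      then have "Q \<noteq> {}" using Q(2) by auto
      then have "0 < card Q" using finQ by (simp add: card_gt_0_iff)
      then show ?thesis using \<open>\<not> 2 \<le> card P\<close> by linarith
    qed simp
    then have "2 * (2 * r) * (real (card P) - real (card Q)) \<le> 0"
      using r by (intro mult_nonneg_nonpos) auto
    moreover have "?m (r / 4) \<le> ?m (r / 2)"
    proof (rule measure_mono_fmeasurable)
      show "nbhd F (r / 4) \<subseteq> nbhd F (r / 2)"
        unfolding nbhd_def using r by (intro UN_mono subset_ball) auto
      show "nbhd F (r / 2) \<in> fmeasurable \<mu>"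
        using measure_ball_mono(1)[OF nbhd_subset_ball[OF bdd] nbhd_in_sets] nbhd_in_sets
        by (intro fmeasurableI) auto
    qed (rule nbhd_in_sets)
    then have "0 \<le> ?D * (?m (r / 2) - ?m (r / 4))"
      using c C_pos by (intro mult_nonneg_nonneg) auto
    ultimately show ?thesis by linarith
  qed
  then have "?D * ?m (r / 4) + 2 * (2 * r) * (real (card P) - real (card Q)) \<le> ?D * ?m (2 * r / 4)"
    by (simp add: algebra_simps)
  then have "toured_family Q (?D * ?m (2 * r / 4))"
    using Q(1) by (rule toured_family_mono[rotated])
  then show ?thesis using Q(2,3) by blast
qed

text \<open>
  The bound does not depend on the finite set \<open>F\<close>.  Below the least distance between two points
  of \<open>F\<close> the singletons form a separated family with tours of length \<open>0\<close>; the scale is then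
  doubled until it exceeds the diameter of \<open>F\<close>, where a separated family has only one member.
\<close>

lemma finite_set_has_tour:
  assumes conn: "connected (UNIV :: 'a set)" and c: "0 < c" and R: "0 < R"
    and mass: "\<And>x r. x \<in> F \<Longrightarrow> 0 < r \<Longrightarrow> r \<le> R \<Longrightarrow> c * r \<le> measure \<mu> (ball x r)"
    and bdd: "F \<subseteq> ball x0 (R / 2)" and fin: "finite F"
  shows "has_tour F (64 * C ^ 3 / c * measure \<mu> (ball x0 R))"
proof -
  let ?D = "64 * C ^ 3 / c" and ?m = "\<lambda>s. measure \<mu> (nbhd F s)"
  let ?good = "\<lambda>r. \<exists>P. toured_family P (?D * ?m (r / 4)) \<and> \<Union>P = F \<and> separated r P"
  obtain \<delta> where \<delta>: "0 < \<delta>" "\<forall>x\<in>F. \<forall>y\<in>F. x \<noteq> y \<longrightarrow> \<delta> \<le> dist x y"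
    using finite_min_separation[OF fin] .
  obtain n where n: "(1 / 2) ^ n < \<delta> / R"
    using real_arch_pow_inv[of "\<delta> / R" "1 / 2"] \<delta> R by auto
  have D: "0 \<le> ?D" using c C_pos by simp
  \<comment> \<open>Start from the singletons, at a scale below the separation of \<open>F\<close>.\<close>
  have "?good (R * (1 / 2) ^ n)"
  proof (intro exI[of _ "(\<lambda>x. {x}) ` F"] conjI)
    have "0 \<le> ?D * ?m (R * (1 / 2) ^ n / 4)" using D by (intro mult_nonneg_nonneg) auto
    then show "toured_family ((\<lambda>x. {x}) ` F) (?D * ?m (R * (1 / 2) ^ n / 4))"
      unfolding toured_family_def using fin has_tour_singleton by (intro conjI exI[of _ "\<lambda>_. 0"]) auto
    have "R * (1 / 2) ^ n < \<delta>" using n R by (simp add: field_simps)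
    then show "separated (R * (1 / 2) ^ n) ((\<lambda>x. {x}) ` F)"
      using \<delta>(2) unfolding separated_def by force
  qed simp
  then have "?good (R * (1 / 2) ^ (n - k))" if "k \<le> n" for k
    using that
  proof (induction k)
    case (Suc k)
    let ?r = "R * (1 / 2) ^ (n - k)"
    have r: "0 < ?r" using R by simp
    have "(1 / 2 :: real) ^ (n - k) \<le> 1" by (intro power_le_one) auto
    then have rR: "?r \<le> R" using R by (simp add: mult_left_le)
    obtain P where P: "toured_family P (?D * ?m (?r / 4))" "\<Union>P = F" "separated ?r P"
      using Suc by auto
    have "n - k = Suc (n - Suc k)" using Suc.prems by simp
    then have 2: "2 * ?r = R * (1 / 2) ^ (n - Suc k)" by simp
    have mass': "c * (?r / 16) \<le> measure \<mu> (ball x (?r / 16))" if "x \<in> F" for x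
    proof (rule mass[OF that])
      show "0 < ?r / 16" "?r / 16 \<le> R" using r rR by linarith+
    qed
    show ?case
      using toured_family_double_scale[OF conn c r mass' bdd P] unfolding 2 .
  qed simp
  from this[of n] obtain P where P: "toured_family P (?D * ?m (R / 4))" "\<Union>P = F" "separated R P"
    by auto
  obtain l where l: "\<forall>K\<in>P. has_tour K (l K)" "sum l P \<le> ?D * ?m (R / 4)"
    using P(1) unfolding toured_family_def by blast
  have ne: "{} \<notin> P" using P(1) unfolding toured_family_def by blast
  show ?thesis
  proof (cases "F = {}")
    case True
    then show ?thesis by (simp add: has_tour_def)
  next
    case False
    then obtain K where K: "K \<in> P" using P(2) by auto
    have "K' = K" if K': "K' \<in> P" for K'
    proof (rule ccontr)
      assume "K' \<noteq> K"
      moreover obtain a b where "a \<in> K" "b \<in> K'"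
        using K K' ne by (metis ex_in_conv)
      ultimately have "R < dist a b" "a \<in> F" "b \<in> F"
        using P(2,3) K K' unfolding separated_def by blast+
      moreover from this have "dist x0 a < R / 2" "dist x0 b < R / 2"
        using bdd by auto
      ultimately show False
        using dist_triangle[of a b x0] by (simp add: dist_commute)
    qed
    then have "P = {K}" using K by blast
    then have "has_tour F (l F)" "l F \<le> ?D * ?m (R / 4)"
      using l P(2) by auto
    moreover have "?m (R / 4) \<le> measure \<mu> (ball x0 R)"
    proof (rule measure_ball_mono(2)[OF _ nbhd_in_sets])
      show "nbhd F (R / 4) \<subseteq> ball x0 R"
        using nbhd_subset_ball[OF bdd, of "R / 4"] R subset_ball[of "R / 2 + R / 4" R x0] by simp
    qed
    then have "?D * ?m (R / 4) \<le> ?D * measure \<mu> (ball x0 R)"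
      using D by (rule mult_left_mono)
    ultimately show ?thesis
      using has_tour_mono by (meson order_trans)
  qed
qed

text \<open>
  All finite subsets of \<open>S\<close> have tours of a common bounded length; compactness turns their arrival
  times into one function \<open>t\<close> on the whole of \<open>S\<close>, whose inverse is the parametrization.
\<close>

lemma lipschitz_parametrization:
  assumes conn: "connected (UNIV :: 'a set)" and c: "0 < c" and R: "0 < R"
    and mass: "\<And>x r. x \<in> S \<Longrightarrow> 0 < r \<Longrightarrow> r \<le> R \<Longrightarrow> c * r \<le> measure \<mu> (ball x r)"
    and bdd: "S \<subseteq> ball x0 (R / 2)"
  shows "\<exists>(A :: real set) f. 1-lipschitz_on A f \<and> f ` A = S"
proof -
  let ?L = "64 * C ^ 3 / c * measure \<mu> (ball x0 R)"
  have L: "0 \<le> ?L" using c C_pos by (intro mult_nonneg_nonneg) auto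
  have "\<exists>t::'a \<Rightarrow> real. \<forall>z\<in>S. \<forall>w\<in>S. dist z w \<le> \<bar>t z - t w\<bar>"
  proof (rule expansion_compactness[OF _ L])
    fix F assume F: "finite F" "F \<subseteq> S"
    have tour: "has_tour F ?L"
      by (rule finite_set_has_tour[OF conn c R]) (use F mass bdd in auto)
    show "\<exists>t. (\<forall>z\<in>F. 0 \<le> t z \<and> t z \<le> ?L) \<and> (\<forall>z\<in>F. \<forall>w\<in>F. dist z w \<le> \<bar>t z - t w\<bar>)"
    proof (cases "F = {}")
      case False
      then obtain x t where "\<forall>z\<in>F. dist x z \<le> t z \<and> t z + dist x z \<le> ?L"
        and e: "\<forall>z\<in>F. \<forall>w\<in>F. dist z w \<le> \<bar>t z - t w\<bar>"
        using tour unfolding has_tour_def by blast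
      then have "\<forall>z\<in>F. 0 \<le> t z \<and> t z \<le> ?L"
        by (smt (verit) zero_le_dist)
      then show ?thesis using e by blast
    qed simp
  qed
  then obtain t :: "'a \<Rightarrow> real" where t: "\<forall>z\<in>S. \<forall>w\<in>S. dist z w \<le> \<bar>t z - t w\<bar>"
    by blast
  have inj: "inj_on t S"
    using t by (intro inj_onI) fastforce
  have "1-lipschitz_on (t ` S) (inv_into S t)"
    using t inj by (intro lipschitz_onI) (auto simp: dist_real_def)
  moreover have "inv_into S t ` t ` S = S"
    using inj by (simp add: inv_into_image_cancel)
  ultimately show ?thesis by blast
qed

end

section \<open>Zero density on Lipschitz images\<close>

text \<open>
  The union over \<open>I\<close> is the limit of the unions over finite initial pieces of an enumeration.
\<close>

lemma emeasure_UN_le_of_finite_sums: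
  assumes I: "countable I" and X: "\<And>i. i \<in> I \<Longrightarrow> X i \<in> sets M"
    and B: "\<And>G. finite G \<Longrightarrow> G \<subseteq> I \<Longrightarrow> (\<Sum>i\<in>G. emeasure M (X i)) \<le> B"
  shows "emeasure M (\<Union>i\<in>I. X i) \<le> B"
proof (cases "I = {}")
  case False
  let ?G = "\<lambda>n::nat. from_nat_into I ` {..n}"
  let ?W = "\<lambda>n. \<Union>i\<in>?G n. X i"
  have G: "finite (?G n)" "?G n \<subseteq> I" for n
    using from_nat_into[OF False] by auto
  have "range (from_nat_into I) = I"
    using range_from_nat_into[OF False I] .
  then have W: "(\<Union>n. ?G n) = I" by (simp add: image_UN[symmetric] UN_atMost_UNIV)
  have "(\<Union>i\<in>(\<Union>n. ?G n). X i) = (\<Union>n. ?W n)" by blast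
  then have "(\<Union>i\<in>I. X i) = (\<Union>n. ?W n)" unfolding W .
  also have "emeasure M (\<Union>n. ?W n) = (SUP n. emeasure M (?W n))"
  proof (rule SUP_emeasure_incseq[symmetric])
    show "range ?W \<subseteq> sets M"
      using X from_nat_into[OF False] by (intro image_subsetI sets.finite_UN) auto
    show "incseq ?W"
      by (intro monoI UN_mono image_mono) auto
  qed
  also have "\<dots> \<le> B"
  proof (rule SUP_least)
    fix n
    have "emeasure M (?W n) \<le> (\<Sum>i\<in>?G n. emeasure M (X i))"
      using G X by (intro emeasure_subadditive_finite) auto
    also have "\<dots> \<le> B" by (rule B[OF G])
    finally show "emeasure M (?W n) \<le> B" .
  qed
  finally show ?thesis .
qed simp

context doubling_space
begin

lemma lower_density1_pos_iff:
  "0 < lower_density1 \<mu> x \<longleftrightarrow>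
    (\<exists>c>0. \<exists>\<delta>>0. \<forall>r. 0 < r \<longrightarrow> r < \<delta> \<longrightarrow> c * r \<le> measure \<mu> (ball x r))"
proof
  assume "0 < lower_density1 \<mu> x"
  then obtain y where y: "0 < y" "y < lower_density1 \<mu> x"
    using dense by blast
  then obtain c where c: "y = ennreal c" "0 < c"
    by (cases y) auto
  have "eventually (\<lambda>r. y < emeasure \<mu> (ball x r) / ennreal r) (at_right 0)"
    using less_LiminfD y(2) unfolding lower_density1_def by blast
  then obtain \<delta> where \<delta>: "0 < \<delta>" "\<And>r. 0 < r \<Longrightarrow> r < \<delta> \<Longrightarrow> y < emeasure \<mu> (ball x r) / ennreal r"
    unfolding eventually_at_right_field by auto
  have "c * r \<le> measure \<mu> (ball x r)" if r: "0 < r" "r < \<delta>" for r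
  proof -
    have "ennreal c < ennreal (measure \<mu> (ball x r) / r)"
      using \<delta>(2)[OF r] r by (simp add: c emeasure_ball divide_ennreal)
    then have "c < measure \<mu> (ball x r) / r"
      using c r by (subst (asm) ennreal_less_iff) auto
    then show ?thesis using r by (simp add: field_simps)
  qed
  then show "\<exists>c>0. \<exists>\<delta>>0. \<forall>r. 0 < r \<longrightarrow> r < \<delta> \<longrightarrow> c * r \<le> measure \<mu> (ball x r)"
    using c \<delta> by blast
next
  assume "\<exists>c>0. \<exists>\<delta>>0. \<forall>r. 0 < r \<longrightarrow> r < \<delta> \<longrightarrow> c * r \<le> measure \<mu> (ball x r)"
  then obtain c \<delta> where c: "0 < c" and \<delta>: "0 < \<delta>" "\<And>r. 0 < r \<Longrightarrow> r < \<delta> \<Longrightarrow> c * r \<le> measure \<mu> (ball x r)"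
    by blast
  have "eventually (\<lambda>r. ennreal c \<le> emeasure \<mu> (ball x r) / ennreal r) (at_right 0)"
    unfolding eventually_at_right_field
  proof (intro exI[of _ \<delta>] conjI allI impI \<delta>(1))
    fix r :: real assume r: "0 < r" "r < \<delta>"
    have "c \<le> measure \<mu> (ball x r) / r"
      using \<delta>(2)[OF r] r by (simp add: field_simps)
    then show "ennreal c \<le> emeasure \<mu> (ball x r) / ennreal r"
      using r by (simp add: emeasure_ball divide_ennreal ennreal_leI)
  qed
  then have "ennreal c \<le> lower_density1 \<mu> x"
    unfolding lower_density1_def by (rule Liminf_bounded)
  then show "0 < lower_density1 \<mu> x"
    using c by (metis ennreal_less_zero_iff less_le_trans)
qed

text \<open>
  About a point \<open>f t\<close> of zero density there is a ball of some radius \<open>L * \<rho> t\<close> whose measure is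
  at most \<open>\<epsilon> * \<rho> t\<close>.  The Vitali lemma, applied to the parameter intervals instead of the balls in
  the space, selects disjoint intervals whose fivefold enlargements still cover \<open>A\<close>; the sum of
  their lengths is bounded by the length of \<open>{a - 1..b + 1}\<close>, and doubling pays for the
  enlargement.
\<close>

lemma zero_density_lipschitz_image_cover:
  fixes f :: "real \<Rightarrow> 'a"
  assumes lip: "L-lipschitz_on A f" and L: "1 \<le> L" and A: "A \<subseteq> {a..b}" "a \<le> b" and \<epsilon>: "0 < \<epsilon>"
    and zero: "\<And>t. t \<in> A \<Longrightarrow> lower_density1 \<mu> (f t) = 0"
  shows "\<exists>V\<in>sets \<mu>. f ` A \<subseteq> V \<and> emeasure \<mu> V \<le> ennreal (C ^ 3 * \<epsilon> * (b - a + 2))"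
proof -
  have "\<exists>\<rho>. 0 < \<rho> \<and> \<rho> \<le> 1 \<and> measure \<mu> (ball (f t) (L * \<rho>)) \<le> \<epsilon> * \<rho>" if "t \<in> A" for t
  proof -
    have "\<not> 0 < lower_density1 \<mu> (f t)" using zero[OF that] by simp
    then obtain r where r: "0 < r" "r < L" "\<not> \<epsilon> / L * r \<le> measure \<mu> (ball (f t) r)"
      unfolding lower_density1_pos_iff using \<epsilon> L by (metis divide_pos_pos less_le_trans zero_less_one)
    then show ?thesis
      using L by (intro exI[of _ "r / L"]) (auto simp: field_simps)
  qed
  then obtain \<rho> where \<rho>: "\<And>t. t \<in> A \<Longrightarrow> 0 < \<rho> t \<and> \<rho> t \<le> 1"
    and small: "\<And>t. t \<in> A \<Longrightarrow> measure \<mu> (ball (f t) (L * \<rho> t)) \<le> \<epsilon> * \<rho> t"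
    by metis
  have "A \<subseteq> (\<Union>t\<in>A. cball t (\<rho> t))"
    using \<rho> by (force intro: less_imp_le)
  then obtain I where I: "countable I" "I \<subseteq> A"
    and disj: "pairwise (\<lambda>i j. disjnt (cball i (\<rho> i)) (cball j (\<rho> j))) I"
    and cover: "A \<subseteq> (\<Union>t\<in>I. cball t (5 * \<rho> t))"
    using Vitali_covering_lemma_cballs[where S = A and K = A and a = "\<lambda>t. t" and r = \<rho> and B = 1] \<rho> by blast
  \<comment> \<open>The factor 5 from the covering lemma is rounded up to 8, that is, to three doublings;
    this also puts the images of the closed intervals into open balls.\<close>
  define X where "X t = ball (f t) (8 * (L * \<rho> t))" for t
  have "f ` A \<subseteq> (\<Union>t\<in>I. X t)"
  proof
    fix z assume "z \<in> f ` A"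
    then obtain s where s: "s \<in> A" "z = f s" by blast
    then obtain t where t: "t \<in> I" "dist t s \<le> 5 * \<rho> t" using cover by auto
    have "dist (f t) (f s) \<le> L * dist t s"
      using lipschitz_onD[OF lip] s t I by blast
    also have "\<dots> \<le> L * (5 * \<rho> t)"
      using t L by (intro mult_left_mono) auto
    also have "\<dots> < 8 * (L * \<rho> t)"
      using t(1) I(2) \<rho>[of t] L by auto
    finally show "z \<in> (\<Union>t\<in>I. X t)"
      using s t unfolding X_def by auto
  qed
  moreover have "emeasure \<mu> (\<Union>t\<in>I. X t) \<le> ennreal (C ^ 3 * \<epsilon> * (b - a + 2))"
  proof (rule emeasure_UN_le_of_finite_sums[OF I(1)])
    show "X t \<in> sets \<mu>" for t unfolding X_def by (simp add: open_in_sets)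
    fix G assume G: "finite G" "G \<subseteq> I"
    have GA: "t \<in> A" if "t \<in> G" for t using that G I by blast
    have "(\<Sum>t\<in>G. 2 * \<rho> t) = (\<Sum>t\<in>G. measure lborel (cball t (\<rho> t)))"
      using \<rho> GA by (intro sum.cong) (auto simp: cball_eq_atLeastAtMost less_imp_le)
    also have "\<dots> = measure lborel (\<Union>t\<in>G. cball t (\<rho> t))"
    proof (rule measure_finite_Union[symmetric])
      show "disjoint_family_on (\<lambda>t. cball t (\<rho> t)) G"
        using disj G unfolding disjoint_family_on_def pairwise_def disjnt_def by blast
    qed (use G in \<open>auto simp: cball_eq_atLeastAtMost emeasure_lborel_Icc_eq\<close>)
    also have "\<dots> \<le> measure lborel {a - 1..b + 1}"
    proof (rule measure_mono_fmeasurable)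
      show "(\<Union>t\<in>G. cball t (\<rho> t)) \<subseteq> {a - 1..b + 1}"
      proof
        fix z assume "z \<in> (\<Union>t\<in>G. cball t (\<rho> t))"
        then obtain t where t: "t \<in> G" "\<bar>t - z\<bar> \<le> \<rho> t" by (auto simp: dist_real_def)
        then have "a \<le> t" "t \<le> b" "\<rho> t \<le> 1" using GA[OF t(1)] A(1) \<rho> by auto
        then show "z \<in> {a - 1..b + 1}" using t(2) by auto
      qed
    next
      show "{a - 1..b + 1} \<in> fmeasurable lborel"
        by (intro fmeasurableI) (auto simp: emeasure_lborel_Icc_eq)
    qed (use G in auto)
    also have "\<dots> = b - a + 2" using A(2) by simp
    finally have sum: "2 * (\<Sum>t\<in>G. \<rho> t) \<le> b - a + 2" unfolding sum_distrib_left .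
    have "(\<Sum>t\<in>G. emeasure \<mu> (X t)) \<le> (\<Sum>t\<in>G. ennreal (C ^ 3 * (\<epsilon> * \<rho> t)))"
    proof (rule sum_mono)
      fix t assume t: "t \<in> G"
      have "measure \<mu> (X t) \<le> C ^ 3 * measure \<mu> (ball (f t) (L * \<rho> t))"
        unfolding X_def using \<rho>[OF GA[OF t]] L by (intro measure_ball_eight) auto
      also have "\<dots> \<le> C ^ 3 * (\<epsilon> * \<rho> t)"
        using small[OF GA[OF t]] C_pos by (intro mult_left_mono) auto
      finally show "emeasure \<mu> (X t) \<le> ennreal (C ^ 3 * (\<epsilon> * \<rho> t))"
        unfolding X_def emeasure_ball by (rule ennreal_leI)
    qed
    also have "\<dots> = ennreal (\<Sum>t\<in>G. C ^ 3 * (\<epsilon> * \<rho> t))"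
      using C_pos \<epsilon> \<rho> GA by (intro sum_ennreal) (auto intro!: mult_nonneg_nonneg less_imp_le)
    also have "(\<Sum>t\<in>G. C ^ 3 * (\<epsilon> * \<rho> t)) = C ^ 3 * \<epsilon> * (\<Sum>t\<in>G. \<rho> t)"
      by (simp add: sum_distrib_left mult.assoc)
    also have "\<dots> \<le> C ^ 3 * \<epsilon> * (b - a + 2)"
    proof (rule mult_left_mono)
      have "0 \<le> (\<Sum>t\<in>G. \<rho> t)" using \<rho> GA by (intro sum_nonneg) (auto intro: less_imp_le)
      then show "(\<Sum>t\<in>G. \<rho> t) \<le> b - a + 2" using sum by linarith
    qed (use C_pos \<epsilon> in auto)
    finally show "(\<Sum>t\<in>G. emeasure \<mu> (X t)) \<le> ennreal (C ^ 3 * \<epsilon> * (b - a + 2))"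
      by (simp add: ennreal_leI)
  qed
  moreover have "(\<Union>t\<in>I. X t) \<in> sets \<mu>"
    unfolding X_def by (intro open_in_sets) auto
  ultimately show ?thesis by blast
qed

lemma zero_density_lipschitz_image_null:
  fixes f :: "real \<Rightarrow> 'a"
  assumes lip: "L-lipschitz_on A f" and A: "A \<subseteq> {a..b}" "a \<le> b"
    and zero: "\<And>t. t \<in> A \<Longrightarrow> lower_density1 \<mu> (f t) = 0"
  shows "f ` A \<in> null_sets (completion \<mu>)"
proof -
  have lip': "(max L 1)-lipschitz_on A f"
    by (rule lipschitz_on_le[OF lip]) simp
  define M where "M = C ^ 3 * (b - a + 2)"
  have M: "0 < M" using C_pos A by (simp add: M_def)
  have "\<exists>V\<in>sets \<mu>. f ` A \<subseteq> V \<and> emeasure \<mu> V \<le> ennreal (inverse (real (Suc n)))" for n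
  proof -
    let ?e = "inverse (real (Suc n)) / M"
    have "0 < ?e" using M by simp
    then have "\<exists>V\<in>sets \<mu>. f ` A \<subseteq> V \<and> emeasure \<mu> V \<le> ennreal (C ^ 3 * ?e * (b - a + 2))"
      by (intro zero_density_lipschitz_image_cover[OF lip' _ A _ zero]) auto
    also have "C ^ 3 * ?e * (b - a + 2) = ?e * M" unfolding M_def by (simp only: ac_simps)
    also have "?e * M = inverse (real (Suc n))" using M by simp
    finally show ?thesis .
  qed
  then obtain V where V: "\<And>n. V n \<in> sets \<mu>" "\<And>n. f ` A \<subseteq> V n"
    "\<And>n. emeasure \<mu> (V n) \<le> ennreal (inverse (real (Suc n)))"
    by metis
  have N: "(\<Inter>n. V n) \<in> sets \<mu>" using V(1) by auto
  have "emeasure \<mu> (\<Inter>n. V n) \<le> ennreal (inverse (real (Suc n)))" for n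
    by (rule order_trans[OF emeasure_mono V(3)]) (use V(1) in auto)
  moreover have "(\<lambda>n. ennreal (inverse (real (Suc n)))) \<longlonglongrightarrow> ennreal 0"
    by (intro tendsto_ennrealI LIMSEQ_inverse_real_of_nat)
  ultimately have "emeasure \<mu> (\<Inter>n. V n) \<le> ennreal 0"
    by (intro LIMSEQ_le_const[of _ "ennreal 0"]) auto
  then have "(\<Inter>n. V n) \<in> null_sets \<mu>"
    using N by (intro null_setsI) auto
  moreover have "f ` A \<subseteq> (\<Inter>n. V n)"
    by (rule INT_greatest) (rule V(2))
  ultimately show ?thesis
    by (rule null_sets_completion_iff2[THEN iffD2, OF bexI, rotated])
qed

section \<open>Rectifiability and positive lower density\<close>

text \<open>
  The parameter sets are cut into bounded pieces, to which the preceding lemma applies.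
\<close>

lemma rectifiable1_imp_density_pos:
  assumes "rectifiable1 \<mu> E"
  shows "AE x in \<mu>. x \<in> E \<longrightarrow> lower_density1 \<mu> x > 0"
proof -
  obtain A :: "nat \<Rightarrow> real set" and f :: "nat \<Rightarrow> real \<Rightarrow> 'a"
    where lip: "\<forall>i. \<exists>L. L-lipschitz_on (A i) (f i)"
      and rest: "E - (\<Union>i. f i ` A i) \<in> null_sets (completion \<mu>)"
    using assms unfolding rectifiable1_def by blast
  let ?B = "\<lambda>i n. A i \<inter> {-real n..real n} \<inter> {t. lower_density1 \<mu> (f i t) = 0}"
  have "f i ` ?B i n \<in> null_sets (completion \<mu>)" for i n
  proof -
    obtain L where "L-lipschitz_on (A i) (f i)" using lip by blast
    then have "L-lipschitz_on (?B i n) (f i)"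
      by (rule lipschitz_on_subset) auto
    then show ?thesis
      by (rule zero_density_lipschitz_image_null[of _ _ _ "- real n" "real n"]) auto
  qed
  then have "(\<Union>i. \<Union>n. f i ` ?B i n) \<in> null_sets (completion \<mu>)"
    by (intro null_sets_UN)
  with rest have "(E - (\<Union>i. f i ` A i)) \<union> (\<Union>i. \<Union>n. f i ` ?B i n) \<in> null_sets (completion \<mu>)"
    by (rule null_sets.Un)
  moreover have "{x \<in> E. lower_density1 \<mu> x = 0} \<subseteq> (E - (\<Union>i. f i ` A i)) \<union> (\<Union>i. \<Union>n. f i ` ?B i n)"
  proof
    fix x assume x: "x \<in> {x \<in> E. lower_density1 \<mu> x = 0}"
    show "x \<in> (E - (\<Union>i. f i ` A i)) \<union> (\<Union>i. \<Union>n. f i ` ?B i n)"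
    proof (cases "x \<in> (\<Union>i. f i ` A i)")
      case True
      then obtain i t where t: "t \<in> A i" "x = f i t" by blast
      obtain n where "\<bar>t\<bar> \<le> real n" using real_arch_simple by blast
      then have "t \<in> ?B i n" using t x by auto
      then have "x \<in> f i ` ?B i n" unfolding t(2) by (rule imageI)
      then show ?thesis by blast
    next
      case False
      then show ?thesis using x by blast
    qed
  qed
  ultimately have "{x \<in> E. lower_density1 \<mu> x = 0} \<in> null_sets (completion \<mu>)"
    by (rule null_sets_completion_subset[rotated])
  then obtain N where N: "N \<in> null_sets \<mu>" "{x \<in> E. lower_density1 \<mu> x = 0} \<subseteq> N"
    by (auto simp: null_sets_completion_iff2)
  show ?thesis
    by (rule AE_I'[OF N(1)]) (use N(2) in \<open>auto simp: zero_less_iff_neq_zero\<close>)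
qed

text \<open>
  Positive lower density at \<open>x\<close> bounds \<open>measure \<mu> (ball x r) / r\<close> from below for small \<open>r\<close>, and
  for \<open>r\<close> up to the fixed bound \<open>R\<close> it stays away from \<open>0\<close> because balls have positive measure.
  So the points of positive density are exhausted by the countably many sets \<open>S n\<close> on which the
  lower bound is uniform, and each of them is a single Lipschitz image.
\<close>

lemma density_pos_imp_rectifiable1:
  assumes conn: "connected (UNIV :: 'a set)" and supp: "measure_support \<mu> = UNIV"
    and E: "compact E" and dens: "AE x in \<mu>. x \<in> E \<longrightarrow> lower_density1 \<mu> x > 0"
  shows "rectifiable1 \<mu> E"
proof -
  obtain x0 R where R: "0 < R" "E \<subseteq> ball x0 (R / 2)"
  proof -
    fix x0
    obtain r where "\<forall>y\<in>E. dist x0 y \<le> r"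
      using compact_imp_bounded[OF E] bounded_any_center by blast
    then have "E \<subseteq> ball x0 (2 * (\<bar>r\<bar> + 1) / 2)" "0 < 2 * (\<bar>r\<bar> + 1)" by fastforce+
    then show thesis using that by blast
  qed
  define S where "S n = {x \<in> E. \<forall>r. 0 < r \<longrightarrow> r \<le> R \<longrightarrow> 1 / real (Suc n) * r \<le> measure \<mu> (ball x r)}" for n
  have "\<exists>(A :: real set) f. 1-lipschitz_on A f \<and> f ` A = S n" for n
    by (rule lipschitz_parametrization[OF conn _ R(1), of "1 / real (Suc n)"])
      (use R(2) in \<open>auto simp: S_def\<close>)
  then obtain A :: "nat \<Rightarrow> real set" and f where lip: "\<And>n. 1-lipschitz_on (A n) (f n)"
    and im: "\<And>n. f n ` A n = S n"
    by metis
  have mem: "x \<in> (\<Union>n. S n)" if x: "x \<in> E" "lower_density1 \<mu> x > 0" for x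
  proof -
    obtain c \<delta> where c: "0 < c" and \<delta>: "0 < \<delta>" "\<forall>r. 0 < r \<longrightarrow> r < \<delta> \<longrightarrow> c * r \<le> measure \<mu> (ball x r)"
      using x(2) unfolding lower_density1_pos_iff by blast
    have "0 < emeasure \<mu> (ball x \<delta>)"
      using supp \<delta>(1) unfolding measure_support_def by blast
    then have m: "0 < measure \<mu> (ball x \<delta>)"
      by (simp add: emeasure_ball)
    let ?c = "min c (measure \<mu> (ball x \<delta>) / R)"
    have "0 < ?c" using c m R by simp
    then obtain n where n: "inverse (real (Suc n)) < ?c" using reals_Archimedean by blast
    have "1 / real (Suc n) * r \<le> measure \<mu> (ball x r)" if r: "0 < r" "r \<le> R" for r
    proof -
      have "1 / real (Suc n) * r \<le> ?c * r"
        using n r by (intro mult_right_mono) (auto simp: inverse_eq_divide)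
      also have "\<dots> \<le> measure \<mu> (ball x r)"
      proof (cases "r < \<delta>")
        case True
        have "?c * r \<le> c * r" using r by (intro mult_right_mono) auto
        then show ?thesis using \<delta> r True by (meson order_trans)
      next
        case False
        have "?c * r \<le> measure \<mu> (ball x \<delta>) / R * R"
          using r m R by (intro mult_mono) auto
        also have "\<dots> = measure \<mu> (ball x \<delta>)" using R by simp
        also have "\<dots> \<le> measure \<mu> (ball x r)"
          using False by (intro measure_ball_mono subset_ball open_in_sets) auto
        finally show ?thesis .
      qed
      finally show ?thesis .
    qed
    then show ?thesis using x unfolding S_def by blast
  qed
  obtain N where N: "{x \<in> space \<mu>. \<not> (x \<in> E \<longrightarrow> lower_density1 \<mu> x > 0)} \<subseteq> N" "N \<in> null_sets \<mu>"
    using AE_E[OF dens] by (metis null_setsI)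
  have "space \<mu> = UNIV"
    using sets_eq_imp_space_eq[OF sets_borel] by simp
  then have "E - (\<Union>n. f n ` A n) \<subseteq> N"
    using N(1) mem unfolding im by blast
  then have "E - (\<Union>n. f n ` A n) \<in> null_sets (completion \<mu>)"
    using N(2) by (rule null_sets_completion_iff2[THEN iffD2, OF bexI])
  moreover have "E \<in> sets borel"
    using E by (intro borel_closed compact_imp_closed)
  ultimately show ?thesis
    unfolding rectifiable1_def using lip by blast
qed

end

theorem theorem1p3:
  fixes \<mu> :: "'a::metric_space measure" and E :: "'a set"
  assumes "connected (UNIV :: 'a set)"
    and "doubling_measure \<mu>"
    and "measure_support \<mu> = UNIV"
    and "compact E"
  shows "rectifiable1 \<mu> E \<longleftrightarrow> (AE x in \<mu>. x \<in> E \<longrightarrow> lower_density1 \<mu> x > 0)"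
proof -
  obtain C where "doubling_space \<mu> C"
    using assms(2) unfolding doubling_measure_def doubling_space_def by blast
  then interpret doubling_space \<mu> C .
  show ?thesis
    using rectifiable1_imp_density_pos density_pos_imp_rectifiable1[OF assms(1,3,4)] by blast
qed

end
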